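(* Let $F=(f_1,f_2,\dots)$ be a sequence of functions with $f_i\in F_i$ for every $i\ge1$ and $f_i(k)\le f_{i+1}(k)$ for all $i\ge1$ and $1\le k\le i$. Then for every positive integer $m$, the rooted tree $Tree_m^F$ is strongly $m$-universal for the class of rooted trees.
   Context: For a positive integer $p$, $F_p$ is the set of functions $f:\{1,\dots,p\}\to\{0,1,\dots,\lfloor p/2\rfloor\}$ such that for every $n\in\{1,\dots,p\}$ and every integer $1\le i\le\lfloor n/2\rfloor$ there exists an integer $k$ with $n-i+1\le k\le n$ and $f(k)\ge i$. A rooted tree is a tree with a distinguished vertex, the root. For rooted trees $T_1,\dots,T_k$ (possibly empty, taken as disjoint copies), $[T_1,\dots,T_k]$ is the rooted tree obtained from a path $v_1v_2\cdots v_{k+1}$ (with $k$ edges) by adding, for each $j$ with $T_j$ nonempty, the tree $T_j$ and the edge $\{v_j,r(T_j)\}$ where $r(T_j)$ is the root of $T_j$; its root is $v_1$. Define rooted trees $T_n$ for $n\ge -1$ by: $T_{-1}=\emptyset$ (empty tree), $T_0$ a single vertex, and for $n\ge1$, $T_n=[T_{\min(f_n(n)-1,\,n-1)},\,T_{\min(f_n(n-1)-1,\,n-1)},\,\dots,\,T_{\min(f_n(1)-1,\,n-1)}]$ (the $j$-th entry is $T_{\min(f_n(n+1-j)-1,\,n-1)}$). Then $Tree_m^F:=T_m$. A rooted contraction of a rooted tree $T$ is a rooted tree obtained from $T$ by successively contracting edges, the root of the result being the image of the root of $T$. A rooted tree $U$ is strongly $m$-universal for the class of rooted trees if every rooted tree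 with $m$ edges is a rooted contraction of $U$. *)

theory Defs
  imports Main "HOL-Library.FuncSet"
begin

text \<open>Values of the functions outside \<open>{1..p}\<close> are unconstrained; nothing below depends on them.\<close>

definition F_set :: "nat \<Rightarrow> (nat \<Rightarrow> nat) set" where
  "F_set p = {f \<in> {1..p} \<rightarrow> {0..p div 2}.
     \<forall>n\<in>{1..p}. \<forall>i. 1 \<le> i \<and> i \<le> n div 2 \<longrightarrow> (\<exists>k. n - i + 1 \<le> k \<and> k \<le> n \<and> i \<le> f k)}"

record 'a rgraph =
  rverts :: "'a set"
  redges :: "'a set set"
  rroot :: 'a

definition simple_graph :: "'a set \<Rightarrow> 'a set set \<Rightarrow> bool" where
  "simple_graph V E \<longleftrightarrow> finite V \<and> (\<forall>e\<in>E. \<exists>u\<in>V. \<exists>v\<in>V. u \<noteq> v \<and> e = {u, v})"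

definition connected_graph :: "'a set \<Rightarrow> 'a set set \<Rightarrow> bool" where
  "connected_graph V E \<longleftrightarrow> V \<noteq> {} \<and> (\<forall>u\<in>V. \<forall>v\<in>V. (\<lambda>x y. {x, y} \<in> E)\<^sup>*\<^sup>* u v)"

definition is_cycle :: "'a set set \<Rightarrow> 'a list \<Rightarrow> bool" where
  "is_cycle E xs \<longleftrightarrow> 3 \<le> length xs \<and> distinct xs \<and>
     successively (\<lambda>x y. {x, y} \<in> E) xs \<and> {last xs, hd xs} \<in> E"

definition is_tree :: "'a set \<Rightarrow> 'a set set \<Rightarrow> bool" where
  "is_tree V E \<longleftrightarrow> simple_graph V E \<and> connected_graph V E \<and> (\<nexists>xs. is_cycle E xs)"

definition rooted_tree :: "'a rgraph \<Rightarrow> bool" where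
  "rooted_tree T \<longleftrightarrow> is_tree (rverts T) (redges T) \<and> rroot T \<in> rverts T"

definition rooted_iso :: "'a rgraph \<Rightarrow> 'b rgraph \<Rightarrow> bool" where
  "rooted_iso S T \<longleftrightarrow> (\<exists>\<phi>. bij_betw \<phi> (rverts S) (rverts T) \<and>
     (\<lambda>e. \<phi> ` e) ` redges S = redges T \<and> \<phi> (rroot S) = rroot T)"

text \<open>Contraction of the edge \<open>{u, v}\<close>; the merged vertex keeps the name \<open>u\<close>.\<close>

definition contract_edge :: "'a \<Rightarrow> 'a \<Rightarrow> 'a rgraph \<Rightarrow> 'a rgraph" where
  "contract_edge u v T =
     (let \<phi> = (\<lambda>x. if x = v then u else x)
      in \<lparr>rverts = \<phi> ` rverts T,
          redges = (\<lambda>e. \<phi> ` e) ` (redges T - {{u, v}}),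
          rroot = \<phi> (rroot T)\<rparr>)"

definition contract_step :: "'a rgraph \<Rightarrow> 'a rgraph \<Rightarrow> bool" where
  "contract_step T T' \<longleftrightarrow> (\<exists>u v. {u, v} \<in> redges T \<and> T' = contract_edge u v T)"

definition rooted_contraction :: "'b rgraph \<Rightarrow> 'a rgraph \<Rightarrow> bool" where
  "rooted_contraction R T \<longleftrightarrow> (\<exists>T'. contract_step\<^sup>*\<^sup>* T T' \<and> rooted_iso R T')"

text \<open>
  The first argument only fixes the type of the vertices of the rooted trees that are to be
  found as contractions; statements are meant to hold for every such type.
\<close>

definition strongly_universal :: "'b itself \<Rightarrow> nat \<Rightarrow> 'a rgraph \<Rightarrow> bool" where
  "strongly_universal _ m U \<longleftrightarrow> rooted_tree U \<and>
     (\<forall>R :: 'b rgraph. rooted_tree R \<and> card (redges R) = m \<longrightarrow> rooted_contraction R U)"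

text \<open>
  Concrete vertices for \<open>[T\<^sub>1, \<dots>, T\<^sub>k]\<close>: \<open>Spine j\<close> is the path vertex \<open>v\<^sub>j\<close>, and
  \<open>Copy j x\<close> is the vertex \<open>x\<close> of the disjoint copy of \<open>T\<^sub>j\<close>. The empty tree is \<open>None\<close>.
\<close>

datatype vertex = Spine nat | Copy nat vertex

definition bracket :: "vertex rgraph option list \<Rightarrow> vertex rgraph" where
  "bracket Ts =
     (let k = length Ts
      in \<lparr>rverts = Spine ` {1..k + 1} \<union>
            \<Union>{Copy j ` rverts T | j T. j \<in> {1..k} \<and> Ts ! (j - 1) = Some T},
          redges = {{Spine j, Spine (j + 1)} | j. j \<in> {1..k}} \<union>
            \<Union>{(\<lambda>e. Copy j ` e) ` redges T | j T. j \<in> {1..k} \<and> Ts ! (j - 1) = Some T} \<union>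
            {{Spine j, Copy j (rroot T)} | j T. j \<in> {1..k} \<and> Ts ! (j - 1) = Some T},
          rroot = Spine 1\<rparr>)"

definition single_vertex :: "vertex rgraph" where
  "single_vertex = \<lparr>rverts = {Spine 1}, redges = {}, rroot = Spine 1\<rparr>"

text \<open>The index of the sequence \<open>T\<^sub>n\<close> starts at \<open>-1\<close>; smaller indices never occur.\<close>

function T_seq :: "(nat \<Rightarrow> nat \<Rightarrow> nat) \<Rightarrow> int \<Rightarrow> vertex rgraph option" where
  "T_seq f n =
     (if n < 0 then None
      else if n = 0 then Some single_vertex
      else Some (bracket
        (map (\<lambda>j. T_seq f (min (int (f (nat n) (nat n + 1 - j)) - 1) (n - 1))) [1..<nat n + 1])))"
  by pat_completeness auto
termination
  by (relation "measure (\<lambda>(f, n). nat (n + 1))") auto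

declare T_seq.simps [simp del]

text \<open>\<open>T_seq f n\<close> is never \<open>None\<close> for \<open>n \<ge> 0\<close>.\<close>

definition Tree_F :: "(nat \<Rightarrow> nat \<Rightarrow> nat) \<Rightarrow> nat \<Rightarrow> vertex rgraph" where
  "Tree_F f m = the (T_seq f (int m))"

lemma T_seq_of_nat: "T_seq f (int m) = Some (Tree_F f m)"
  unfolding Tree_F_def by (subst (1 2) T_seq.simps) simp

end

theory Submission
  imports Defs
begin

text \<open>
  By induction on the number \<open>m\<close> of edges of \<open>R\<close>, one shows that \<open>R\<close> is a contraction of every
  \<open>[T\<^bsub>g(n)-1\<^esub>, \<dots>, T\<^bsub>g(1)-1\<^esub>]\<close> with \<open>n \<ge> m\<close> and \<open>g \<ge> f\<^sub>m\<close> on \<open>{1..m}\<close>. Allowing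
  \<open>n\<close> and \<open>g\<close> to exceed \<open>m\<close> and \<open>f\<^sub>m\<close> makes a separate comparison of the \<open>T\<^sub>n\<close> unnecessary.
  If the root of \<open>R\<close> has a single child, match the root with the spine vertex that carries
  \<open>T\<^bsub>g(m)-1\<^esub>\<close>, and the rest of \<open>R\<close> with the rest of the spine. Otherwise some branch at the root,
  its edge to the root included, has \<open>i \<le> m div 2\<close> edges. The condition on \<open>f\<^sub>m\<close> gives a \<open>k > m - i\<close>
  with \<open>g(k) \<ge> i\<close>: the branch is found in \<open>T\<^bsub>g(k)-1\<^esub>\<close>, the other \<open>m - i\<close> edges in the
  remaining spine of length \<open>k - 1 \<ge> m - i\<close>, and everything before is contracted into the root.
\<close>

section \<open>Trees\<close>

abbreviation adj :: "'a set set \<Rightarrow> 'a \<Rightarrow> 'a \<Rightarrow> bool" where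
  "adj E \<equiv> \<lambda>x y. {x, y} \<in> E"

lemma adj_rtranclp_sym: "(adj E)\<^sup>*\<^sup>* x y \<Longrightarrow> (adj E)\<^sup>*\<^sup>* y x"
  by (rule sympD[OF symp_rtranclp]) (auto simp: symp_def insert_commute)

lemma adj_rtranclp_mono: "(adj E)\<^sup>*\<^sup>* x y \<Longrightarrow> E \<subseteq> F \<Longrightarrow> (adj F)\<^sup>*\<^sup>* x y"
  by (erule mono_rtranclp[rule_format, rotated]) auto

text \<open>Loop erasure: when the walk returns to a vertex already on the path, the path is cut
  back to that vertex. Distinctness is what \<open>is_cycle\<close> asks for.\<close>

lemma rtranclp_imp_distinct_path:
  assumes "r\<^sup>*\<^sup>* x y"
  obtains xs where "xs \<noteq> []" "distinct xs" "successively r xs" "hd xs = x" "last xs = y"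
proof -
  from assms have "\<exists>xs. xs \<noteq> [] \<and> distinct xs \<and> successively r xs \<and> hd xs = x \<and> last xs = y"
  proof (induction rule: rtranclp_induct)
    case base
    show ?case by (intro exI[of _ "[x]"]) auto
  next
    case (step y z)
    then obtain xs where xs: "xs \<noteq> []" "distinct xs" "successively r xs" "hd xs = x" "last xs = y"
      by blast
    show ?case
    proof (cases "z \<in> set xs")
      case True
      then obtain ys zs where "xs = ys @ z # zs" by (meson split_list)
      then show ?thesis
        using xs by (intro exI[of _ "ys @ [z]"]) (auto simp: successively_append_iff hd_append)
    next
      case False
      then show ?thesis
        using xs step(2) by (intro exI[of _ "xs @ [z]"]) (auto simp: successively_append_iff)
    qed
  qed
  then show thesis using that by blast
qed

lemma successively_imp_rtranclp:
  "successively r xs \<Longrightarrow> xs \<noteq> [] \<Longrightarrow> r\<^sup>*\<^sup>* (hd xs) (last xs)"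
proof (induction xs rule: induct_list012)
  case (3 x y zs)
  then show ?case by (auto intro: converse_rtranclp_into_rtranclp)
qed auto

text \<open>A simple path avoiding the edge between its ends closes up to a cycle; conversely, a
  cycle minus one edge is a detour around that edge. The bridge form speaks only of reachability, so
  it passes easily to subgraphs and joins.\<close>

lemma no_cycle_iff_bridges:
  "(\<nexists>xs. is_cycle E xs) \<longleftrightarrow>
     (\<forall>u v. u \<noteq> v \<longrightarrow> {u, v} \<in> E \<longrightarrow> \<not> (adj (E - {{u, v}}))\<^sup>*\<^sup>* u v)"
proof (intro iffI allI impI notI; (elim exE)?)
  fix u v assume nc: "\<nexists>xs. is_cycle E xs" and uv: "u \<noteq> v" "{u, v} \<in> E"
    and path: "(adj (E - {{u, v}}))\<^sup>*\<^sup>* u v"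
  from path obtain xs where xs: "xs \<noteq> []" "distinct xs"
    "successively (adj (E - {{u, v}})) xs" "hd xs = u" "last xs = v"
    by (rule rtranclp_imp_distinct_path)
  obtain x y zs where "xs = x # y # zs"
    using xs uv by (cases xs rule: remdups_adj.cases) auto
  \<comment> \<open>With only two vertices the path would be the removed edge itself.\<close>
  moreover have "zs \<noteq> []" using xs calculation by auto
  ultimately have "3 \<le> length xs" by (cases zs) auto
  moreover have "successively (adj E) xs"
    using xs(3) by (rule successively_mono) auto
  ultimately have "is_cycle E xs"
    using xs uv by (auto simp: is_cycle_def insert_commute)
  with nc show False by blast
next
  fix xs
  assume bridge: "\<forall>u v. u \<noteq> v \<longrightarrow> {u, v} \<in> E \<longrightarrow> \<not> (adj (E - {{u, v}}))\<^sup>*\<^sup>* u v"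
    and cyc: "is_cycle E xs"
  then obtain x y z zs where xs: "xs = x # y # z # zs"
    by (cases xs; cases "tl xs"; cases "tl (tl xs)") (auto simp: is_cycle_def)
  \<comment> \<open>The edge from \<open>w\<close> to \<open>x\<close> closes the cycle; it is the
    one shown not to be a bridge.\<close>
  define w where "w = last (z # zs)"
  have w: "w \<in> set (z # zs)" unfolding w_def by (rule last_in_set) simp
  have d: "distinct (x # y # z # zs)" and s: "successively (adj E) (y # z # zs)"
    and xy: "{x, y} \<in> E" and wx: "{w, x} \<in> E"
    using cyc by (auto simp: is_cycle_def xs w_def)
  have "successively (adj (E - {{x, w}})) (y # z # zs)"
    using s by (rule successively_mono) (use d in \<open>auto simp: doubleton_eq_iff\<close>)
  from successively_imp_rtranclp[OF this] have "(adj (E - {{x, w}}))\<^sup>*\<^sup>* y w"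
    by (simp add: w_def)
  moreover have "adj (E - {{x, w}}) x y"
    using xy d w by (auto simp: doubleton_eq_iff)
  ultimately have "(adj (E - {{x, w}}))\<^sup>*\<^sup>* x w"
    by (rule converse_rtranclp_into_rtranclp[rotated])
  moreover have "x \<noteq> w" using d w by auto
  moreover have "{x, w} \<in> E" using wx by (simp add: insert_commute)
  ultimately show False using bridge by blast
qed

section \<open>Rooted trees as iterated joins\<close>

abbreviation point :: "'a \<Rightarrow> 'a rgraph" where
  "point r \<equiv> \<lparr>rverts = {r}, redges = {}, rroot = r\<rparr>"

text \<open>\<open>H\<close> becomes a branch at the root of \<open>G\<close>. This one operation
  describes both the decomposition of \<open>R\<close> and the spine with its hanging trees.\<close>

definition join :: "'a rgraph \<Rightarrow> 'a rgraph \<Rightarrow> 'a rgraph" where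
  "join G H = \<lparr>rverts = rverts G \<union> rverts H,
     redges = insert {rroot G, rroot H} (redges G \<union> redges H), rroot = rroot G\<rparr>"

lemma join_sel [simp]:
  "rverts (join G H) = rverts G \<union> rverts H"
  "redges (join G H) = insert {rroot G, rroot H} (redges G \<union> redges H)"
  "rroot (join G H) = rroot G"
  by (simp_all add: join_def)

text \<open>Two branches at the same root may be attached in either order.\<close>

lemma join_right_commute: "join (join G H) K = join (join G K) H"
  by (auto simp: join_def)

text \<open>A recursive description of the finite rooted trees, shown equivalent to
  \<open>rooted_tree\<close> below. It supplies induction and case distinction at an edge of the
  root.\<close>

inductive built_tree :: "'a rgraph \<Rightarrow> bool" where
  built_point: "built_tree (point r)"
| built_join: "built_tree G \<Longrightarrow> built_tree H \<Longrightarrow> rverts G \<inter> rverts H = {} \<Longrightarrow> built_tree (join G H)"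

lemma built_tree_root: "built_tree G \<Longrightarrow> rroot G \<in> rverts G"
  by (induction rule: built_tree.induct) auto

lemma built_tree_simple: "built_tree G \<Longrightarrow> simple_graph (rverts G) (redges G)"
proof (induction rule: built_tree.induct)
  case (built_join G H)
  have neq: "rroot G \<noteq> rroot H"
    using built_join built_tree_root by (metis IntI empty_iff)
  have r: "rroot G \<in> rverts G" "rroot H \<in> rverts H"
    using built_join by (auto intro: built_tree_root)
  have "\<exists>u\<in>rverts (join G H). \<exists>v\<in>rverts (join G H). u \<noteq> v \<and> e = {u, v}"
    if "e \<in> redges (join G H)" for e
  proof -
    from that consider "e = {rroot G, rroot H}" | "e \<in> redges G" | "e \<in> redges H" by auto
    then show ?thesis
    proof cases
      case 1
      with r neq show ?thesis by (intro bexI[of _ "rroot G"] bexI[of _ "rroot H"]) auto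
    next
      case 2
      with built_join.IH(1) show ?thesis unfolding simple_graph_def join_sel by blast
    next
      case 3
      with built_join.IH(2) show ?thesis unfolding simple_graph_def join_sel by blast
    qed
  qed
  then show ?case using built_join.IH by (simp add: simple_graph_def)
qed (simp add: simple_graph_def)

lemma simple_edge_in: "simple_graph V E \<Longrightarrow> {a, b} \<in> E \<Longrightarrow> a \<in> V \<and> b \<in> V \<and> a \<noteq> b"
  unfolding simple_graph_def by (drule conjunct2, drule (1) bspec) (auto simp: doubleton_eq_iff)

lemma simple_graph_finite_edges:
  assumes "simple_graph V E"
  shows "finite E"
proof (rule finite_subset)
  show "E \<subseteq> Pow V"
  proof
    fix e assume "e \<in> E"
    then obtain u v where "u \<in> V" "v \<in> V" "e = {u, v}"
      using assms unfolding simple_graph_def by blast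
    then show "e \<in> Pow V" by simp
  qed
  show "finite (Pow V)" using assms by (simp add: simple_graph_def)
qed

lemma built_tree_path_root: "built_tree G \<Longrightarrow> x \<in> rverts G \<Longrightarrow> (adj (redges G))\<^sup>*\<^sup>* x (rroot G)"
proof (induction arbitrary: x rule: built_tree.induct)
  case (built_join G H)
  show ?case
  proof (cases "x \<in> rverts G")
    case True
    from built_join.IH(1)[OF this] show ?thesis
      unfolding join_sel by (rule adj_rtranclp_mono) auto
  next
    case False
    with built_join.prems have "(adj (redges H))\<^sup>*\<^sup>* x (rroot H)"
      by (auto intro: built_join.IH(2))
    then have "(adj (redges (join G H)))\<^sup>*\<^sup>* x (rroot H)"
      by (rule adj_rtranclp_mono) auto
    then show ?thesis
      by (rule rtranclp.rtrancl_into_rtrancl) (auto simp: insert_commute)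
  qed
qed simp

lemma built_tree_connected:
  assumes "built_tree G"
  shows "connected_graph (rverts G) (redges G)"
  unfolding connected_graph_def
proof (intro conjI ballI)
  show "rverts G \<noteq> {}" using built_tree_root[OF assms] by blast
  show "(adj (redges G))\<^sup>*\<^sup>* x y" if "x \<in> rverts G" "y \<in> rverts G" for x y
    using that built_tree_path_root[OF assms] by (blast intro: rtranclp_trans adj_rtranclp_sym)
qed

lemma rtranclp_adj_closed:
  assumes "(adj E)\<^sup>*\<^sup>* x y" "x \<in> W" "\<And>a b. {a, b} \<in> E \<Longrightarrow> a \<in> W \<Longrightarrow> b \<in> W"
  shows "y \<in> W"
  using assms by (induction rule: rtranclp_induct) blast+

text \<open>Collapsing the far side onto \<open>r\<close> turns the walk into one inside \<open>V\<close>.\<close>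

lemma adj_rtranclp_one_side_of_bridge:
  assumes path: "(adj (insert {r, s} (E \<union> F) - {e}))\<^sup>*\<^sup>* u v"
    and sV: "simple_graph V E" and sW: "simple_graph W F" and disj: "V \<inter> W = {}"
    and r: "r \<in> V" and s: "s \<in> W" and uv: "u \<in> V" "v \<in> V"
  shows "(adj (E - {e}))\<^sup>*\<^sup>* u v"
proof -
  define \<rho> where "\<rho> x = (if x \<in> V then x else r)" for x
  have "(adj (E - {e}))\<^sup>*\<^sup>* (\<rho> u) (\<rho> v)"
    using path
  proof (induction rule: rtranclp_induct)
    case (step y z)
    from step(2) consider "{y, z} = {r, s}" | "{y, z} \<in> E - {e}" | "{y, z} \<in> F" by auto
    then show ?case
    proof cases
      case 1
      then have "\<rho> y = \<rho> z" using r s disj by (auto simp: \<rho>_def doubleton_eq_iff)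
      then show ?thesis using step.IH by (simp only:)
    next
      case 2
      then have "\<rho> y = y" "\<rho> z = z" using simple_edge_in[OF sV, of y z] by (auto simp: \<rho>_def)
      then show ?thesis using step.IH 2 by (metis (no_types, lifting) rtranclp.rtrancl_into_rtrancl)
    next
      case 3
      then have "\<rho> y = \<rho> z" using simple_edge_in[OF sW 3] disj by (auto simp: \<rho>_def)
      then show ?thesis using step.IH by (simp only:)
    qed
  qed simp
  then show ?thesis using uv by (simp add: \<rho>_def)
qed

text \<open>The joining edge is the only one between the two sides, so it is a bridge. A detour
  around any other edge projects to a detour on the side of that edge.\<close>

lemma built_tree_bridges:
  "built_tree G \<Longrightarrow> u \<noteq> v \<Longrightarrow> {u, v} \<in> redges G \<Longrightarrow> \<not> (adj (redges G - {{u, v}}))\<^sup>*\<^sup>* u v"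
proof (induction arbitrary: u v rule: built_tree.induct)
  case (built_join G H)
  have sG: "simple_graph (rverts G) (redges G)" and sH: "simple_graph (rverts H) (redges H)"
    and rG: "rroot G \<in> rverts G" and rH: "rroot H \<in> rverts H"
    using built_join by (auto intro: built_tree_simple built_tree_root)
  have disj: "rverts G \<inter> rverts H = {}" by fact
  show ?case
  proof
    assume path: "(adj (redges (join G H) - {{u, v}}))\<^sup>*\<^sup>* u v"
    consider "{u, v} = {rroot G, rroot H}" | "{u, v} \<in> redges G" | "{u, v} \<in> redges H"
      using built_join.prems by auto
    then show False
    proof cases
      case 1
      \<comment> \<open>Without the joining edge, both \<open>rverts G\<close> and its complement
        are closed under adjacency.\<close>
      have "b \<in> rverts G \<longleftrightarrow> a \<in> rverts G" if "{a, b} \<in> redges (join G H) - {{u, v}}" for a b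
        using that 1 disj simple_edge_in[OF sG, of a b] simple_edge_in[OF sH, of a b] by auto
      then have "u \<in> rverts G \<Longrightarrow> v \<in> rverts G" "u \<in> - rverts G \<Longrightarrow> v \<in> - rverts G"
        using rtranclp_adj_closed[OF path, of "rverts G"]
          rtranclp_adj_closed[OF path, of "- rverts G"] by blast+
      then show False using 1 rG rH disj by (auto simp: doubleton_eq_iff)
    next
      case 2
      from simple_edge_in[OF sG 2] have "(adj (redges G - {{u, v}}))\<^sup>*\<^sup>* u v"
        by (intro adj_rtranclp_one_side_of_bridge[OF path[unfolded join_sel] sG sH disj rG rH]) auto
      then show False using built_join.IH(1) 2 built_join.prems by blast
    next
      case 3
      \<comment> \<open>The same projection with the roles of \<open>G\<close> and \<open>H\<close>
        exchanged.\<close>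
      have "(adj (insert {rroot H, rroot G} (redges H \<union> redges G) - {{u, v}}))\<^sup>*\<^sup>* u v"
        using path by (simp only: join_sel insert_commute Un_commute)
      from adj_rtranclp_one_side_of_bridge[OF this sH sG _ rH rG]
      have "(adj (redges H - {{u, v}}))\<^sup>*\<^sup>* u v"
        using disj simple_edge_in[OF sH 3] by blast
      then show False using built_join.IH(2) 3 built_join.prems by blast
    qed
  qed
qed simp

lemma built_tree_imp_rooted_tree: "built_tree G \<Longrightarrow> rooted_tree G"
  unfolding rooted_tree_def is_tree_def no_cycle_iff_bridges
  by (intro conjI allI impI built_tree_simple built_tree_connected built_tree_bridges built_tree_root)

text \<open>Deleting an edge at the root, a bridge, leaves two smaller trees, rooted at its two
  ends; the given tree is their join.\<close>

lemma rooted_tree_imp_built_tree: "rooted_tree G \<Longrightarrow> built_tree G"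
proof (induction "card (rverts G)" arbitrary: G rule: less_induct)
  case less
  define V where "V = rverts G"
  define E where "E = redges G"
  define r where "r = rroot G"
  have G: "G = \<lparr>rverts = V, redges = E, rroot = r\<rparr>" by (simp add: V_def E_def r_def)
  have s: "simple_graph V E" and c: "connected_graph V E" and r: "r \<in> V"
    and br: "\<And>u v. u \<noteq> v \<Longrightarrow> {u, v} \<in> E \<Longrightarrow> \<not> (adj (E - {{u, v}}))\<^sup>*\<^sup>* u v"
    using less.prems unfolding rooted_tree_def is_tree_def no_cycle_iff_bridges
    by (auto simp: V_def E_def r_def)
  have fin: "finite V" using s by (simp add: simple_graph_def)
  show ?case
  proof (cases "V = {r}")
    case True
    then have "E = {}" using s unfolding simple_graph_def by auto
    with True show ?thesis by (simp add: G built_point)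
  next
    case False
    then obtain x where x: "x \<in> V" "x \<noteq> r" using r by auto
    then have "(adj E)\<^sup>*\<^sup>* r x" using c r by (auto simp: connected_graph_def)
    \<comment> \<open>The first edge of a walk from the root to another vertex yields a child
      \<open>a\<close> of the root.\<close>
    then obtain a where ra: "{r, a} \<in> E" using x by (cases rule: converse_rtranclpE) auto
    have aV: "a \<in> V" and neq: "r \<noteq> a" using simple_edge_in[OF s ra] by auto
    define E' where "E' = E - {{r, a}}"
    \<comment> \<open>The component of \<open>b\<close> after deletion of the edge, rooted at
      \<open>b\<close>; only \<open>b = r\<close> and \<open>b = a\<close> matter.\<close>
    define C where "C b = \<lparr>rverts = {y. (adj E')\<^sup>*\<^sup>* b y},
      redges = {e \<in> E'. e \<subseteq> {y. (adj E')\<^sup>*\<^sup>* b y}}, rroot = b\<rparr>" for b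
    have C_sub: "rverts (C b) \<subseteq> V" if "b \<in> V" for b
    proof
      fix y assume "y \<in> rverts (C b)"
      then have "(adj E')\<^sup>*\<^sup>* b y" by (simp add: C_def)
      then show "y \<in> V"
        using that by (rule rtranclp_adj_closed) (use simple_edge_in[OF s] in \<open>auto simp: E'_def\<close>)
    qed
    have C_edge: "{y, z} \<in> redges (C b)" if "y \<in> rverts (C b)" "{y, z} \<in> E'" for y z b
      using that by (simp add: C_def) (metis (no_types, lifting) rtranclp.rtrancl_into_rtrancl)
    have nra: "\<not> (adj E')\<^sup>*\<^sup>* r a" using br neq ra by (simp add: E'_def)
    have disj: "rverts (C r) \<inter> rverts (C a) = {}"
    proof -
      have False if "(adj E')\<^sup>*\<^sup>* r y" "(adj E')\<^sup>*\<^sup>* a y" for y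
        using nra rtranclp_trans[OF that(1) adj_rtranclp_sym[OF that(2)]] by contradiction
      then show ?thesis by (auto simp: C_def)
    qed
    have C_tree: "rooted_tree (C b)" if b: "b \<in> V" for b
    proof -
      have "simple_graph (rverts (C b)) (redges (C b))"
        unfolding simple_graph_def
      proof (intro conjI ballI)
        show "finite (rverts (C b))" using C_sub[OF b] fin by (rule finite_subset)
        fix e assume e: "e \<in> redges (C b)"
        then have "e \<in> E" "e \<subseteq> rverts (C b)" by (auto simp: C_def E'_def)
        moreover from \<open>e \<in> E\<close> obtain u v where "u \<noteq> v" "e = {u, v}"
          using s unfolding simple_graph_def by blast
        ultimately show "\<exists>u\<in>rverts (C b). \<exists>v\<in>rverts (C b). u \<noteq> v \<and> e = {u, v}"
          by blast
      qed
      moreover have path: "(adj (redges (C b)))\<^sup>*\<^sup>* b y" if "y \<in> rverts (C b)" for y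
      proof -
        have "(adj E')\<^sup>*\<^sup>* b y" using that by (simp add: C_def)
        then show ?thesis
        proof (induction rule: rtranclp_induct)
          case (step y z)
          then have "{y, z} \<in> redges (C b)" by (intro C_edge) (auto simp: C_def)
          then show ?case by (rule rtranclp.rtrancl_into_rtrancl[OF step(3)])
        qed simp
      qed
      then have "connected_graph (rverts (C b)) (redges (C b))"
        unfolding connected_graph_def
      proof (intro conjI ballI)
        show "rverts (C b) \<noteq> {}" by (auto simp: C_def)
      qed (rule rtranclp_trans[OF adj_rtranclp_sym[OF path] path])
      moreover have "\<not> (adj (redges (C b) - {{u, v}}))\<^sup>*\<^sup>* u v"
        if "u \<noteq> v" "{u, v} \<in> redges (C b)" for u v
      proof
        assume "(adj (redges (C b) - {{u, v}}))\<^sup>*\<^sup>* u v"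
        then have "(adj (E - {{u, v}}))\<^sup>*\<^sup>* u v"
          by (rule adj_rtranclp_mono) (auto simp: C_def E'_def)
        moreover have "{u, v} \<in> E" using that by (simp add: C_def E'_def)
        ultimately show False using br that(1) by blast
      qed
      ultimately show ?thesis
        unfolding rooted_tree_def is_tree_def no_cycle_iff_bridges by (simp add: C_def)
    qed
    have rC: "r \<in> rverts (C r)" "a \<in> rverts (C a)" by (auto simp: C_def)
    have "rverts (C r) \<subset> V" "rverts (C a) \<subset> V"
      using C_sub r aV rC disj by blast+
    then have built: "built_tree (C r)" "built_tree (C a)"
      using less.hyps C_tree r aV fin by (auto simp: V_def intro: psubset_card_mono)
    have V_un: "V = rverts (C r) \<union> rverts (C a)"
    proof
      show "V \<subseteq> rverts (C r) \<union> rverts (C a)"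
      proof
        fix y assume "y \<in> V"
        \<comment> \<open>Along a walk from \<open>r\<close>, each step stays in its component or
          crosses the deleted edge from one root to the other.\<close>
        then have "(adj E)\<^sup>*\<^sup>* r y" using c r by (auto simp: connected_graph_def)
        then show "y \<in> rverts (C r) \<union> rverts (C a)"
        proof (induction rule: rtranclp_induct)
          case base
          then show ?case using rC by auto
        next
          case (step y z)
          show ?case
          proof (cases "{y, z} = {r, a}")
            case True
            then show ?thesis using rC by (auto simp: doubleton_eq_iff)
          next
            case False
            with step(2) have "{y, z} \<in> E'" by (simp add: E'_def)
            with step(3) show ?thesis
              by (simp add: C_def) (metis (no_types, lifting) rtranclp.rtrancl_into_rtrancl)
          qed
        qed
      qed
      show "rverts (C r) \<union> rverts (C a) \<subseteq> V" using C_sub r aV by blast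
    qed
    have E_un: "E = insert {r, a} (redges (C r) \<union> redges (C a))"
    proof
      show "insert {r, a} (redges (C r) \<union> redges (C a)) \<subseteq> E"
        using ra by (auto simp: C_def E'_def)
      show "E \<subseteq> insert {r, a} (redges (C r) \<union> redges (C a))"
      proof
        fix e assume e: "e \<in> E"
        then obtain u v where uv: "e = {u, v}" "u \<in> V" using s unfolding simple_graph_def by blast
        then show "e \<in> insert {r, a} (redges (C r) \<union> redges (C a))"
          using C_edge[of u _ v] e V_un by (auto simp: E'_def)
      qed
    qed
    have "G = join (C r) (C a)"
      using V_un E_un by (simp add: G join_def) (simp add: C_def)
    then show ?thesis using built_join[OF built disj] by simp
  qed
qed

section \<open>Counting edges and splitting off a branch\<close>

lemma built_tree_connectedD:
  "built_tree G \<Longrightarrow> x \<in> rverts G \<Longrightarrow> y \<in> rverts G \<Longrightarrow> (adj (redges G))\<^sup>*\<^sup>* x y"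
  using built_tree_connected by (auto simp: connected_graph_def)

text \<open>Each old edge has both ends on one side, while the joining edge has an end on either
  side, so nothing is counted twice.\<close>

lemma built_tree_join_disjoint_edges:
  assumes "built_tree G" "built_tree H" "rverts G \<inter> rverts H = {}"
  shows "card (redges (join G H)) = card (redges G) + card (redges H) + 1"
proof -
  note sG = built_tree_simple[OF assms(1)] and sH = built_tree_simple[OF assms(2)]
  have pair: "\<exists>a b. e = {a, b}" if "simple_graph V E" "e \<in> E" for V E and e :: "'a set"
    using that unfolding simple_graph_def by blast
  have "redges G \<inter> redges H = {}"
    using pair[OF sG] simple_edge_in[OF sG] simple_edge_in[OF sH] assms(3) by blast
  moreover have "{rroot G, rroot H} \<notin> redges G \<union> redges H"
    using simple_edge_in[OF sG, of "rroot G" "rroot H"] simple_edge_in[OF sH, of "rroot G" "rroot H"]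
      built_tree_root[OF assms(1)] built_tree_root[OF assms(2)] assms(3) by blast
  ultimately show ?thesis
    using simple_graph_finite_edges[OF sG] simple_graph_finite_edges[OF sH]
    by (simp add: card_Un_disjoint)
qed

lemma built_tree_no_edges: "built_tree R \<Longrightarrow> redges R = {} \<Longrightarrow> R = point (rroot R)"
  by (cases rule: built_tree.cases) auto

text \<open>If a branch \<open>A\<close> is too large, any other branch at the root is small.\<close>

lemma built_tree_split_small_branch:
  assumes "built_tree R" "redges R \<noteq> {}"
  obtains A B where "built_tree A" "built_tree B" "rverts B \<inter> rverts A = {}" "R = join B A"
    "redges B = {} \<or> 2 * (card (redges A) + 1) \<le> card (redges R)"
proof -
  from assms obtain A B where R: "R = join B A" and b: "built_tree B" "built_tree A"
    and d: "rverts B \<inter> rverts A = {}"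
    by (cases rule: built_tree.cases) auto
  show thesis
  proof (cases "redges B = {} \<or> 2 * (card (redges A) + 1) \<le> card (redges R)")
    case True
    then show thesis using that[of A B] R b d by blast
  next
    case False
    \<comment> \<open>\<open>B\<close> has an edge, so it splits in turn; \<open>A'\<close> is
      another branch at the same root.\<close>
    from b(1) False obtain A' B' where B: "B = join B' A'" and b': "built_tree B'" "built_tree A'"
      and d': "rverts B' \<inter> rverts A' = {}"
      by (cases rule: built_tree.cases) auto
    have "built_tree (join B' A)" using b' b d B by (intro built_join) auto
    moreover have "rverts (join B' A) \<inter> rverts A' = {}" using d d' B by auto
    moreover have "R = join (join B' A) A'" using R B by (simp add: join_right_commute)
    \<comment> \<open>The branches \<open>A\<close> and \<open>A'\<close>, root edges included,
      share no edge, and \<open>A\<close> already takes more than half of all edges.\<close>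
    moreover have "2 * (card (redges A') + 1) \<le> card (redges R)"
    proof -
      have "card (redges R) < 2 * (card (redges A) + 1)" using False by linarith
      then show ?thesis
        using built_tree_join_disjoint_edges[OF b d] built_tree_join_disjoint_edges[OF b' d']
        unfolding R B by presburger
    qed
    ultimately show thesis using that b' by blast
  qed
qed

text \<open>Used with \<open>Copy s\<close> to form the disjoint copies that hang from the
  spine.\<close>

definition map_rgraph :: "('a \<Rightarrow> 'b) \<Rightarrow> 'a rgraph \<Rightarrow> 'b rgraph" where
  "map_rgraph h G =
     \<lparr>rverts = h ` rverts G, redges = (`) h ` redges G, rroot = h (rroot G)\<rparr>"

lemma map_rgraph_sel [simp]:
  "rverts (map_rgraph h G) = h ` rverts G"
  "redges (map_rgraph h G) = (`) h ` redges G"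
  "rroot (map_rgraph h G) = h (rroot G)"
  by (simp_all add: map_rgraph_def)

lemma map_rgraph_join: "map_rgraph h (join G H) = join (map_rgraph h G) (map_rgraph h H)"
  by (simp add: map_rgraph_def join_def image_Un)

lemma built_tree_map:
  assumes "built_tree G" "inj h"
  shows "built_tree (map_rgraph h G)"
  using assms(1)
proof (induction rule: built_tree.induct)
  case (built_point r)
  then show ?case using built_tree.built_point[of "h r"] by (simp add: map_rgraph_def)
next
  case (built_join G H)
  then show ?case
    unfolding map_rgraph_join
    by (intro built_tree.built_join) (simp_all add: image_Int[OF assms(2), symmetric])
qed

section \<open>Contractions\<close>

text \<open>Removing the singletons discards the images of the contracted edges.\<close>

definition contraction_map :: "('a \<Rightarrow> 'b) \<Rightarrow> 'a rgraph \<Rightarrow> 'b rgraph \<Rightarrow> bool" where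
  "contraction_map \<phi> G R \<longleftrightarrow>
     \<phi> ` rverts G = rverts R \<and> \<phi> (rroot G) = rroot R \<and>
     redges R = (`) \<phi> ` redges G - range (\<lambda>x. {x}) \<and>
     (\<forall>x\<in>rverts G. \<forall>y\<in>rverts G. \<phi> x = \<phi> y \<longrightarrow> (adj {e \<in> redges G. \<phi> ` e = {\<phi> x}})\<^sup>*\<^sup>* x y)"

lemma contraction_map_fiber:
  "contraction_map \<phi> G R \<Longrightarrow> x \<in> rverts G \<Longrightarrow> y \<in> rverts G \<Longrightarrow> \<phi> x = \<phi> y \<Longrightarrow>
     (adj {e \<in> redges G. \<phi> ` e = {\<phi> x}})\<^sup>*\<^sup>* x y"
  unfolding contraction_map_def by blast

definition contracts_to :: "'a rgraph \<Rightarrow> 'b rgraph \<Rightarrow> bool" where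
  "contracts_to G R \<longleftrightarrow> (\<exists>\<phi>. contraction_map \<phi> G R)"

text \<open>For \<open>S\<close> the set of singletons: deleting an edge that is collapsed anyway
  leaves the edges of the image unchanged.\<close>

lemma image_Diff_singleton_Diff: "f d \<in> S \<Longrightarrow> f ` (X - {d}) - S = f ` X - S"
  by auto

text \<open>Merging \<open>v\<close> into \<open>u\<close> inside a fibre is invisible to \<phi>, so
  the same map works after the contraction. The vertex count gives the measure for contracting
  repeatedly.\<close>

lemma contraction_map_contract_edge:
  assumes \<phi>: "contraction_map \<phi> G R" and s: "simple_graph (rverts G) (redges G)"
    and uv: "{u, v} \<in> redges G" "\<phi> u = \<phi> v"
  defines "H \<equiv> contract_edge u v G"
  shows "contraction_map \<phi> H R" "simple_graph (rverts H) (redges H)"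
    "card (rverts H) < card (rverts G)"
proof -
  define \<rho> where "\<rho> x = (if x = v then u else x)" for x
  have H: "H = \<lparr>rverts = \<rho> ` rverts G, redges = (`) \<rho> ` (redges G - {{u, v}}), rroot = \<rho> (rroot G)\<rparr>"
    by (simp add: H_def contract_edge_def Let_def \<rho>_def[abs_def])
  have \<phi>\<rho> [simp]: "\<phi> (\<rho> x) = \<phi> x" for x by (simp add: \<rho>_def uv)
  have im [simp]: "\<phi> ` \<rho> ` S = \<phi> ` S" for S by (simp add: image_image)
  have uvV: "u \<in> rverts G" "v \<in> rverts G" "u \<noteq> v" using simple_edge_in[OF s uv(1)] by auto
  have fin: "finite (rverts G)" using s by (simp add: simple_graph_def)
  have vH: "\<rho> ` rverts G = rverts G - {v}" using uvV by (auto simp: \<rho>_def)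
  show "card (rverts H) < card (rverts G)"
    using card_Diff1_less[OF fin uvV(2)] by (simp add: H vH)
  show "simple_graph (rverts H) (redges H)"
    unfolding simple_graph_def
  proof (intro conjI ballI)
    show "finite (rverts H)" using fin by (simp add: H)
    fix e assume "e \<in> redges H"
    then obtain d where d: "d \<in> redges G" "d \<noteq> {u, v}" "e = \<rho> ` d" by (auto simp: H)
    from d(1) obtain a b where ab: "a \<in> rverts G" "b \<in> rverts G" "a \<noteq> b" "d = {a, b}"
      using s unfolding simple_graph_def by blast
    \<comment> \<open>Distinct ends are identified only if they are \<open>u\<close> and
      \<open>v\<close>, and that edge is gone.\<close>
    then have "\<rho> a \<noteq> \<rho> b" using d(2) by (auto simp: \<rho>_def)
    then show "\<exists>x\<in>rverts H. \<exists>y\<in>rverts H. x \<noteq> y \<and> e = {x, y}"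
      using ab d by (intro bexI[of _ "\<rho> a"] bexI[of _ "\<rho> b"]) (simp_all add: H)
  qed
  have "\<phi> ` \<rho> ` rverts G = rverts R" "\<phi> (rroot H) = rroot R"
    using \<phi> by (auto simp: contraction_map_def H)
  moreover have "redges R = (`) \<phi> ` redges H - range (\<lambda>x. {x})"
  proof -
    have "(`) \<phi> ` redges H = (`) \<phi> ` (redges G - {{u, v}})"
      unfolding H rgraph.select_convs image_image[of "(`) \<phi>"] im ..
    moreover have "\<phi> ` {u, v} \<in> range (\<lambda>x. {x})" using uv by auto
    moreover have "redges R = (`) \<phi> ` redges G - range (\<lambda>x. {x})"
      using \<phi> by (simp add: contraction_map_def)
    ultimately show ?thesis by (simp only: image_Diff_singleton_Diff)
  qed
  moreover have "(adj {e \<in> redges H. \<phi> ` e = {\<phi> x}})\<^sup>*\<^sup>* x y"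
    if "x \<in> rverts H" "y \<in> rverts H" "\<phi> x = \<phi> y" for x y
  proof -
    have xy: "x \<in> rverts G" "y \<in> rverts G" "\<rho> x = x" "\<rho> y = y"
      using that by (auto simp: H vH) (auto simp: \<rho>_def)
    \<comment> \<open>The walk in the old fibre is pushed forward along \<rho>; a step along the
      contracted edge becomes stationary.\<close>
    have "(adj {e \<in> redges H. \<phi> ` e = {\<phi> x}})\<^sup>*\<^sup>* (\<rho> x) (\<rho> y)"
      using contraction_map_fiber[OF \<phi> xy(1,2) that(3)]
    proof (induction rule: rtranclp_induct)
      case (step a b)
      show ?case
      proof (cases "{a, b} = {u, v}")
        case True
        then have "\<rho> a = \<rho> b" by (auto simp: \<rho>_def doubleton_eq_iff)
        then show ?thesis using step.IH by (simp only:)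
      next
        case False
        then have "{a, b} \<in> redges G - {{u, v}}" using step(2) by simp
        then have "\<rho> ` {a, b} \<in> redges H" unfolding H rgraph.select_convs by (rule imageI)
        moreover have "\<phi> ` \<rho> ` {a, b} = {\<phi> x}" using step(2) by simp
        ultimately show ?thesis
          using rtranclp.rtrancl_into_rtrancl[OF step.IH, of "\<rho> b"] by simp
      qed
    qed simp
    then show ?thesis using xy by simp
  qed
  ultimately show "contraction_map \<phi> H R"
    unfolding contraction_map_def by (simp add: H)
qed

text \<open>Edges inside fibres are contracted one by one until the map is injective; its inverse is
  then the required isomorphism.\<close>

lemma contraction_map_imp_rooted_contraction:
  assumes "contraction_map \<phi> G R" "simple_graph (rverts G) (redges G)" "rroot G \<in> rverts G"
  shows "rooted_contraction R G"
  using assms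
proof (induction "card (rverts G)" arbitrary: G rule: less_induct)
  case less
  note \<phi> = less.prems(1) and s = less.prems(2)
  show ?case
  proof (cases "inj_on \<phi> (rverts G)")
    case True
    let ?\<psi> = "inv_into (rverts G) \<phi>"
    have img: "\<phi> ` rverts G = rverts R" using \<phi> by (simp add: contraction_map_def)
    then have bij: "bij_betw ?\<psi> (rverts R) (rverts G)"
      using True by (intro bij_betw_inv_into) (simp add: bij_betw_def)
    \<comment> \<open>An injective map collapses no edge, so no image is discarded as a
      singleton.\<close>
    have edge: "e \<subseteq> rverts G \<and> \<phi> ` e \<notin> range (\<lambda>x. {x})" if e: "e \<in> redges G" for e
    proof -
      from e obtain a b where "a \<in> rverts G" "b \<in> rverts G" "a \<noteq> b" "e = {a, b}"
        using s unfolding simple_graph_def by blast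
      then show ?thesis using inj_onD[OF True, of a b] by (auto simp: doubleton_eq_iff)
    qed
    moreover have "redges R = (`) \<phi> ` redges G - range (\<lambda>x. {x})"
      using \<phi> by (simp add: contraction_map_def)
    ultimately have "redges R = (`) \<phi> ` redges G" by blast
    moreover have "?\<psi> ` \<phi> ` e = e" if "e \<in> redges G" for e
      using edge[OF that] by (intro inv_into_image_cancel[OF True]) simp
    ultimately have "(`) ?\<psi> ` redges R = redges G" by (force simp: image_iff)
    moreover have "?\<psi> (rroot R) = rroot G"
      using \<phi> inv_into_f_f[OF True less.prems(3)] by (simp add: contraction_map_def)
    ultimately have "rooted_iso R G" unfolding rooted_iso_def using bij by blast
    then show ?thesis unfolding rooted_contraction_def by blast
  next
    case False
    then obtain x y where xy: "x \<in> rverts G" "y \<in> rverts G" "\<phi> x = \<phi> y" "x \<noteq> y"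
      unfolding inj_on_def by blast
    \<comment> \<open>A fibre with two vertices is connected by collapsed edges; the first one on a
      walk from \<open>x\<close> can be contracted.\<close>
    from contraction_map_fiber[OF \<phi> xy(1-3)] xy(4)
    obtain b where b: "{x, b} \<in> redges G" "\<phi> ` {x, b} = {\<phi> x}"
      by (cases rule: converse_rtranclpE) auto
    then have eq: "\<phi> x = \<phi> b" by auto
    let ?H = "contract_edge x b G"
    have "rroot ?H \<in> rverts ?H" using less.prems(3) by (simp add: contract_edge_def Let_def)
    then have "rooted_contraction R ?H"
      using less.hyps contraction_map_contract_edge[OF \<phi> s b(1) eq] by blast
    moreover have "contract_step G ?H" unfolding contract_step_def using b(1) by blast
    ultimately show ?thesis
      unfolding rooted_contraction_def by (meson converse_rtranclp_into_rtranclp)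
  qed
qed

section \<open>Contractions of copies and joins\<close>

text \<open>The constant map works because its only fibre, the whole tree, is connected.\<close>

lemma contracts_to_point:
  assumes "built_tree G"
  shows "contracts_to G (point r)"
proof -
  have "e \<noteq> {}" if "e \<in> redges G" for e
    using that built_tree_simple[OF assms] unfolding simple_graph_def by blast
  then have "(\<lambda>_. r) ` e = {r}" if "e \<in> redges G" for e
    using that by auto
  then have "contraction_map (\<lambda>_. r) G (point r)"
    using built_tree_root[OF assms] built_tree_connectedD[OF assms]
    by (auto simp: contraction_map_def image_iff cong: conj_cong)
  then show ?thesis unfolding contracts_to_def by blast
qed

lemma contracts_to_map:
  assumes "contracts_to G R" "inj h"
  shows "contracts_to (map_rgraph h G) R"
proof -
  from assms(1) obtain \<phi> where \<phi>: "contraction_map \<phi> G R" unfolding contracts_to_def by blast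
  let ?\<psi> = "\<phi> \<circ> inv h"
  have img: "?\<psi> ` h ` S = \<phi> ` S" for S using assms(2) by (simp add: image_comp comp_assoc)
  have "(adj {e \<in> (`) h ` redges G. ?\<psi> ` e = {\<phi> x}})\<^sup>*\<^sup>* (h x) (h y)"
    if "x \<in> rverts G" "y \<in> rverts G" "\<phi> x = \<phi> y" for x y
    using contraction_map_fiber[OF \<phi> that]
  proof (induction rule: rtranclp_induct)
    case (step a b)
    have "h ` {a, b} \<in> {e \<in> (`) h ` redges G. ?\<psi> ` e = {\<phi> x}}"
      unfolding mem_Collect_eq img using step(2) by blast
    then show ?case by (intro rtranclp.rtrancl_into_rtrancl[OF step.IH]) simp
  qed simp
  moreover have "(`) ?\<psi> ` (`) h ` redges G = (`) \<phi> ` redges G"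
    unfolding image_image[of "(`) (\<phi> \<circ> inv h)"] img ..
  ultimately have "contraction_map ?\<psi> (map_rgraph h G) R"
    using \<phi> assms(2) unfolding contraction_map_def map_rgraph_sel img by simp
  then show ?thesis unfolding contracts_to_def by blast
qed

text \<open>Edges consist of vertices, so only the values on vertices matter. This allows maps on
  disjoint vertex sets to be glued by cases.\<close>

lemma contraction_map_cong:
  assumes "contraction_map \<phi> G R" "simple_graph (rverts G) (redges G)" "rroot G \<in> rverts G"
    and eq: "\<And>x. x \<in> rverts G \<Longrightarrow> \<psi> x = \<phi> x"
  shows "contraction_map \<psi> G R"
proof -
  have img: "\<psi> ` e = \<phi> ` e" if "e \<in> redges G" for e
  proof -
    from that obtain a b where "a \<in> rverts G" "b \<in> rverts G" "e = {a, b}"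
      using assms(2) unfolding simple_graph_def by blast
    then show ?thesis by (simp add: eq)
  qed
  have "(`) \<psi> ` redges G = (`) \<phi> ` redges G" by (rule image_cong[OF refl img])
  moreover have "\<psi> ` rverts G = \<phi> ` rverts G" by (rule image_cong[OF refl eq])
  moreover have "{e \<in> redges G. \<psi> ` e = c} = {e \<in> redges G. \<phi> ` e = c}" for c using img by auto
  ultimately show ?thesis
    using assms(1,3) eq unfolding contraction_map_def by simp
qed

text \<open>The two maps are glued. Disjointness of \<open>A\<close> and \<open>B\<close> keeps the
  joining edge from collapsing and every fibre on one side.\<close>

lemma contracts_to_join:
  assumes "contracts_to G A" "contracts_to H B" "built_tree G" "built_tree H"
    and disj: "rverts G \<inter> rverts H = {}" and disj': "rverts A \<inter> rverts B = {}"
  shows "contracts_to (join G H) (join A B)"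
proof -
  note sG = built_tree_simple[OF assms(3)] and sH = built_tree_simple[OF assms(4)]
  note rG = built_tree_root[OF assms(3)] and rH = built_tree_root[OF assms(4)]
  from assms obtain \<phi>1 \<phi>2 where \<phi>12: "contraction_map \<phi>1 G A" "contraction_map \<phi>2 H B"
    unfolding contracts_to_def by blast
  define \<phi> where "\<phi> x = (if x \<in> rverts G then \<phi>1 x else \<phi>2 x)" for x
  have \<phi>G: "contraction_map \<phi> G A"
    using \<phi>12(1) sG rG by (rule contraction_map_cong) (simp add: \<phi>_def)
  have \<phi>H: "contraction_map \<phi> H B"
    using \<phi>12(2) sH rH by (rule contraction_map_cong) (use disj in \<open>auto simp: \<phi>_def\<close>)
  have img: "\<phi> ` rverts G = rverts A" "\<phi> ` rverts H = rverts B"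
    "\<phi> (rroot G) = rroot A" "\<phi> (rroot H) = rroot B"
    and edges: "redges A = (`) \<phi> ` redges G - range (\<lambda>x. {x})"
      "redges B = (`) \<phi> ` redges H - range (\<lambda>x. {x})"
    using \<phi>G \<phi>H by (auto simp: contraction_map_def)
  have "rroot A \<in> rverts A" "rroot B \<in> rverts B"
    using imageI[OF rG, of \<phi>] imageI[OF rH, of \<phi>] by (simp_all only: img)
  then have "rroot A \<noteq> rroot B" using disj' by auto
  then have bridge: "{rroot A, rroot B} \<notin> range (\<lambda>x. {x})" by auto
  have "redges (join A B) = (`) \<phi> ` redges (join G H) - range (\<lambda>x. {x})"
    using bridge by (simp add: edges img image_Un insert_Diff_if Un_Diff)
  moreover have "(adj {e \<in> redges (join G H). \<phi> ` e = {\<phi> x}})\<^sup>*\<^sup>* x y"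
    if xy: "x \<in> rverts (join G H)" "y \<in> rverts (join G H)" "\<phi> x = \<phi> y" for x y
  proof -
    have "\<phi> z \<in> rverts A" if "z \<in> rverts G" for z using imageI[OF that, of \<phi>] by (simp only: img)
    moreover have "\<phi> z \<in> rverts B" if "z \<in> rverts H" for z using imageI[OF that, of \<phi>] by (simp only: img)
    ultimately have "x \<in> rverts G \<and> y \<in> rverts G \<or> x \<in> rverts H \<and> y \<in> rverts H"
      using xy disj' by (metis IntI Un_iff empty_iff join_sel(1))
    then show ?thesis
    proof (elim disjE conjE)
      assume "x \<in> rverts G" "y \<in> rverts G"
      from contraction_map_fiber[OF \<phi>G this xy(3)] show ?thesis
        by (rule adj_rtranclp_mono) auto
    next
      assume "x \<in> rverts H" "y \<in> rverts H"
      from contraction_map_fiber[OF \<phi>H this xy(3)] show ?thesis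
        by (rule adj_rtranclp_mono) auto
    qed
  qed
  ultimately have "contraction_map \<phi> (join G H) (join A B)"
    unfolding contraction_map_def by (simp add: img image_Un)
  then show ?thesis unfolding contracts_to_def by blast
qed

text \<open>All of \<open>G\<close>, together with the joining edge, is contracted into the root of
  \<open>H\<close>.\<close>

lemma contracts_to_join_absorb:
  assumes "contracts_to H B" "built_tree G" "built_tree H"
    and disj: "rverts G \<inter> rverts H = {}"
  shows "contracts_to (join G H) B"
proof -
  note sG = built_tree_simple[OF assms(2)] and sH = built_tree_simple[OF assms(3)]
  note rG = built_tree_root[OF assms(2)] and rH = built_tree_root[OF assms(3)]
  from assms obtain \<phi>0 where \<phi>0: "contraction_map \<phi>0 H B"
    unfolding contracts_to_def by blast
  define \<phi> where "\<phi> x = (if x \<in> rverts G then rroot B else \<phi>0 x)" for x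
  have \<phi>H: "contraction_map \<phi> H B"
    using \<phi>0 sH rH by (rule contraction_map_cong) (use disj in \<open>auto simp: \<phi>_def\<close>)
  have \<phi>G: "\<phi> x = rroot B" if "x \<in> rverts G" for x using that by (simp add: \<phi>_def)
  have img: "\<phi> ` rverts H = rverts B" "\<phi> (rroot H) = rroot B"
    and edges: "redges B = (`) \<phi> ` redges H - range (\<lambda>x. {x})"
    using \<phi>H by (auto simp: contraction_map_def)
  have edgeG: "\<phi> ` e = {rroot B}" if "e \<in> redges G" for e
  proof -
    from that obtain a b where "a \<in> rverts G" "b \<in> rverts G" "e = {a, b}"
      using sG unfolding simple_graph_def by blast
    then show ?thesis by (simp add: \<phi>G)
  qed
  let ?F = "\<lambda>c. {e \<in> redges (join G H). \<phi> ` e = {c}}"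
  have "redges B = (`) \<phi> ` redges (join G H) - range (\<lambda>x. {x})"
    using edgeG by (auto simp: edges \<phi>G[OF rG] img(2))
  moreover have "(adj (?F (\<phi> x)))\<^sup>*\<^sup>* x y"
    if xy: "x \<in> rverts (join G H)" "y \<in> rverts (join G H)" "\<phi> x = \<phi> y" for x y
  proof (cases "\<phi> x = rroot B")
    case True
    \<comment> \<open>Only the fibre over the root grows: a vertex of \<open>G\<close> reaches
      \<open>rroot H\<close> through \<open>rroot G\<close> and the joining edge.\<close>
    have to_root: "(adj (?F (rroot B)))\<^sup>*\<^sup>* z (rroot H)"
      if z: "z \<in> rverts (join G H)" "\<phi> z = rroot B" for z
    proof (cases "z \<in> rverts G")
      case True
      then have "(adj (redges G))\<^sup>*\<^sup>* z (rroot G)" by (rule built_tree_path_root[OF assms(2)])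
      then have "(adj (?F (rroot B)))\<^sup>*\<^sup>* z (rroot G)"
        by (rule adj_rtranclp_mono) (use edgeG in auto)
      then show ?thesis
        by (rule rtranclp.rtrancl_into_rtrancl) (simp add: \<phi>G[OF rG] img(2))
    next
      case False
      then have "z \<in> rverts H" "\<phi> z = \<phi> (rroot H)" using z img by auto
      from contraction_map_fiber[OF \<phi>H this(1) rH this(2)] show ?thesis
        by (rule adj_rtranclp_mono) (auto simp: z(2))
    qed
    show ?thesis
      using rtranclp_trans[OF to_root adj_rtranclp_sym[OF to_root]] xy True by simp
  next
    case False
    then have "x \<in> rverts H" "y \<in> rverts H" using xy \<phi>G by auto
    from contraction_map_fiber[OF \<phi>H this xy(3)] show ?thesis
      by (rule adj_rtranclp_mono) auto
  qed
  moreover have "\<phi> ` rverts (join G H) = rverts B"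
  proof -
    have "rroot B \<in> rverts B" using imageI[OF rH, of \<phi>] by (simp only: img)
    then show ?thesis using img(1) \<phi>G by (auto simp: image_Un)
  qed
  ultimately have "contraction_map \<phi> (join G H) B"
    unfolding contraction_map_def by (simp add: \<phi>G[OF rG])
  then show ?thesis unfolding contracts_to_def by blast
qed

section \<open>The trees \<open>T\<^sub>n\<close>\<close>

text \<open>One spine vertex with its hanging tree. The index \<open>s\<close> in both constructors
  keeps the pieces at different spine vertices disjoint.\<close>

fun attachment :: "nat \<Rightarrow> vertex rgraph option \<Rightarrow> vertex rgraph" where
  "attachment s None = point (Spine s)"
| "attachment s (Some T) = join (point (Spine s)) (map_rgraph (Copy s) T)"

text \<open>\<open>bracket\<close> with the spine vertices numbered from \<open>s + 1\<close> instead of \<open>1\<close>.\<close>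

fun bracket_from :: "nat \<Rightarrow> vertex rgraph option list \<Rightarrow> vertex rgraph" where
  "bracket_from s [] = point (Spine (Suc s))"
| "bracket_from s (t # ts) = join (attachment (Suc s) t) (bracket_from (Suc s) ts)"

text \<open>Separates the first list entry in the comprehensions of \<open>bracket\<close>; a
  general \<open>F\<close> covers the vertices, the edges and the links to the spine alike.\<close>

lemma indexed_option_Cons:
  "{F j T | j T. j \<in> {1..length (t # ts)} \<and> (t # ts) ! (j - 1) = Some T} =
     {F 1 T | T. t = Some T} \<union>
     {F (Suc j) T | j T. j \<in> {1..length ts} \<and> ts ! (j - 1) = Some T}" (is "?L = ?A \<union> ?B")
proof (intro set_eqI iffI)
  fix x assume "x \<in> ?L"
  then obtain j T where x: "x = F j T" "j \<in> {1..length (t # ts)}" "(t # ts) ! (j - 1) = Some T"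
    by blast
  then obtain i where i: "j = Suc i" by (cases j) auto
  show "x \<in> ?A \<union> ?B"
  proof (cases i)
    case 0
    then show ?thesis using x i by auto
  next
    case (Suc k)
    then have "x \<in> ?B" using x i by (intro CollectI exI[of _ i] exI[of _ T]) auto
    then show ?thesis ..
  qed
next
  fix x assume "x \<in> ?A \<union> ?B"
  then show "x \<in> ?L"
  proof
    assume "x \<in> ?A"
    then obtain T where "x = F 1 T" "t = Some T" by blast
    then show ?thesis by (intro CollectI exI[of _ 1] exI[of _ T]) auto
  next
    assume "x \<in> ?B"
    then obtain j T where "x = F (Suc j) T" "j \<in> {1..length ts}" "ts ! (j - 1) = Some T" by blast
    then show ?thesis by (intro CollectI exI[of _ "Suc j"] exI[of _ T]) (auto simp: nth_Cons')
  qed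
qed

lemma rroot_attachment [simp]: "rroot (attachment s t) = Spine s"
  by (cases t) auto

lemma rroot_bracket_from [simp]: "rroot (bracket_from s ts) = Spine (Suc s)"
  by (cases ts) auto

lemma verts_attachment:
  "rverts (attachment s t) = insert (Spine s) (\<Union>{Copy s ` rverts T | T. t = Some T})"
  by (cases t) auto

lemma edges_attachment:
  "redges (attachment s t) =
     \<Union>{(`) (Copy s) ` redges T | T. t = Some T} \<union> {{Spine s, Copy s (rroot T)} | T. t = Some T}"
  by (cases t) auto

lemma spine_image_Suc: "f ` {1..Suc k} = insert (f 1) ((\<lambda>j. f (Suc j)) ` {1..k})" for k :: nat
  by (simp add: atLeastAtMost_insertL[symmetric] image_Suc_atLeastAtMost[symmetric] image_image
      del: image_Suc_atLeastAtMost)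

text \<open>A closed form to be compared with \<open>bracket\<close> at \<open>s = 0\<close>; the
  offset is general because each step down the list raises it.\<close>

lemma verts_bracket_from:
  "rverts (bracket_from s ts) = (\<lambda>j. Spine (s + j)) ` {1..length ts + 1} \<union>
     \<Union>{Copy (s + j) ` rverts T | j T. j \<in> {1..length ts} \<and> ts ! (j - 1) = Some T}"
proof (induction ts arbitrary: s)
  case (Cons t ts)
  have "(\<lambda>j. Spine (s + j)) ` {1..length (t # ts) + 1} =
      insert (Spine (s + 1)) ((\<lambda>j. Spine (s + Suc j)) ` {1..length ts + 1})"
    using spine_image_Suc[of "\<lambda>j. Spine (s + j)" "length ts + 1"] by simp
  then show ?case
    unfolding indexed_option_Cons bracket_from.simps join_sel Cons.IH verts_attachment Union_Un_distrib
    by (simp add: Un_ac)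
qed simp

lemma edges_bracket_from:
  "redges (bracket_from s ts) = (\<lambda>j. {Spine (s + j), Spine (s + j + 1)}) ` {1..length ts} \<union>
     \<Union>{(`) (Copy (s + j)) ` redges T | j T. j \<in> {1..length ts} \<and> ts ! (j - 1) = Some T} \<union>
     {{Spine (s + j), Copy (s + j) (rroot T)} | j T. j \<in> {1..length ts} \<and> ts ! (j - 1) = Some T}"
proof (induction ts arbitrary: s)
  case (Cons t ts)
  have "(\<lambda>j. {Spine (s + j), Spine (s + j + 1)}) ` {1..length (t # ts)} =
      insert {Spine (s + 1), Spine (s + 1 + 1)}
        ((\<lambda>j. {Spine (s + Suc j), Spine (s + Suc j + 1)}) ` {1..length ts})"
    using spine_image_Suc[of "\<lambda>j. {Spine (s + j), Spine (s + j + 1)}" "length ts"] by simp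
  then show ?case
    unfolding indexed_option_Cons bracket_from.simps join_sel Cons.IH edges_attachment Union_Un_distrib
    by (simp add: Un_ac)
qed simp

lemma bracket_eq_bracket_from: "bracket ts = bracket_from 0 ts"
proof (rule rgraph.equality)
  show "rverts (bracket ts) = rverts (bracket_from 0 ts)"
    by (simp add: bracket_def Let_def verts_bracket_from)
  show "redges (bracket ts) = redges (bracket_from 0 ts)"
    unfolding bracket_def Let_def edges_bracket_from Setcompr_eq_image[symmetric] by simp
qed (simp_all add: bracket_def Let_def)

text \<open>The index of the spine vertex to which a vertex belongs; it certifies that the pieces of
  a bracket are disjoint.\<close>

fun level :: "vertex \<Rightarrow> nat" where
  "level (Spine j) = j"
| "level (Copy j x) = j"

lemma level_attachment: "v \<in> rverts (attachment s t) \<Longrightarrow> level v = s"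
  by (cases t) auto

lemma level_bracket_from: "v \<in> rverts (bracket_from s ts) \<Longrightarrow> s < level v"
  by (induction ts arbitrary: s) (auto dest: level_attachment Suc_lessD)

lemma attachment_bracket_disjoint:
  "rverts (attachment (Suc s) t) \<inter> rverts (bracket_from (Suc s) ts) = {}"
  using level_attachment level_bracket_from by fastforce

lemma built_tree_attachment: "(\<And>T. t = Some T \<Longrightarrow> built_tree T) \<Longrightarrow> built_tree (attachment s t)"
  by (cases t) (auto intro!: built_point built_join built_tree_map simp: inj_on_def)

lemma built_tree_bracket_from:
  "(\<And>T. Some T \<in> set ts \<Longrightarrow> built_tree T) \<Longrightarrow> built_tree (bracket_from s ts)"
proof (induction ts arbitrary: s)
  case (Cons t ts)
  then show ?case
    by (auto intro!: built_join built_tree_attachment attachment_bracket_disjoint)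
qed (simp add: built_point)

section \<open>Spines carrying trees of the sequence\<close>

text \<open>The arguments of \<open>g\<close> descend along the spine, so removing the first spine
  vertex leaves the same kind of list with the same \<open>g\<close>. A value \<open>g k = 0\<close>
  hangs nothing.\<close>

fun hanging :: "(nat \<Rightarrow> nat \<Rightarrow> nat) \<Rightarrow> (nat \<Rightarrow> nat) \<Rightarrow> nat \<Rightarrow> vertex rgraph option list" where
  "hanging f g 0 = []"
| "hanging f g (Suc n) = T_seq f (int (g (Suc n)) - 1) # hanging f g n"

lemma hanging_conv_map: "hanging f g n = map (\<lambda>j. T_seq f (int (g (n + 1 - j)) - 1)) [1..<n + 1]"
proof (induction n)
  case (Suc n)
  have "[1..<Suc n + 1] = 1 # map Suc [1..<n + 1]"
    by (simp add: map_Suc_upt upt_conv_Cons)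
  then show ?case by (simp add: Suc.IH)
qed simp

lemma set_hanging: "t \<in> set (hanging f g n) \<Longrightarrow> \<exists>k\<in>{1..n}. t = T_seq f (int (g k) - 1)"
  by (induction n) (auto simp: atLeastAtMostSuc_conv)

context
  fixes f :: "nat \<Rightarrow> nat \<Rightarrow> nat"
  assumes f_in: "\<And>i. 1 \<le> i \<Longrightarrow> f i \<in> F_set i"
begin

lemma f_le_half: "k \<in> {1..n} \<Longrightarrow> f n k \<le> n div 2"
  using f_in[of n] unfolding F_set_def by (auto simp: Pi_iff)

text \<open>Since \<open>f n k\<close> is at most \<open>n div 2\<close>, the minimum in
  \<open>T_seq\<close> is its first argument. For \<open>n = 0\<close> the empty list gives the
  single vertex \<open>Spine 1\<close>.\<close>

lemma Tree_F_unfold: "Tree_F f n = bracket_from 0 (hanging f (f n) n)"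
proof (cases "n = 0")
  case True
  then show ?thesis by (simp add: Tree_F_def T_seq.simps single_vertex_def)
next
  case False
  have "map (\<lambda>j. T_seq f (min (int (f n (n + 1 - j)) - 1) (int n - 1))) [1..<n + 1]
      = hanging f (f n) n"
    unfolding hanging_conv_map
  proof (rule map_cong[OF refl])
    fix j assume "j \<in> set [1..<n + 1]"
    then have "f n (n + 1 - j) \<le> n div 2" by (intro f_le_half) auto
    then have "int (f n (n + 1 - j)) - 1 \<le> int n - 1" by simp
    then show "T_seq f (min (int (f n (n + 1 - j)) - 1) (int n - 1))
        = T_seq f (int (f n (n + 1 - j)) - 1)" by (simp only: min_absorb1)
  qed
  then show ?thesis
    using False by (simp add: Tree_F_def T_seq.simps[of f "int n"] bracket_eq_bracket_from)
qed

lemma T_seq_pred: "T_seq f (int k - 1) = (if k = 0 then None else Some (Tree_F f (k - 1)))"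
proof (cases k)
  case 0
  then show ?thesis by (simp add: T_seq.simps)
next
  case (Suc l)
  then show ?thesis using T_seq_of_nat[of f l] by simp
qed

lemma built_tree_Tree_F: "built_tree (Tree_F f n)"
proof (induction n rule: less_induct)
  case (less n)
  show ?case
    unfolding Tree_F_unfold[of n]
  proof (rule built_tree_bracket_from)
    fix T assume "Some T \<in> set (hanging f (f n) n)"
    then obtain k where k: "k \<in> {1..n}" "Some T = T_seq f (int (f n k) - 1)"
      using set_hanging by blast
    then have "T = Tree_F f (f n k - 1)" by (auto simp: T_seq_pred split: if_splits)
    moreover have "f n k - 1 < n" using f_le_half[OF k(1)] k(1) by auto
    ultimately show "built_tree T" using less.IH by simp
  qed
qed

lemma built_tree_T_seq: "T_seq f (int k - 1) = Some T \<Longrightarrow> built_tree T"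
  by (auto simp: T_seq_pred built_tree_Tree_F split: if_splits)

lemma built_tree_bracket_hanging: "built_tree (bracket_from s (hanging f g n))"
  using set_hanging by (intro built_tree_bracket_from) (metis built_tree_T_seq)

section \<open>Induction on the number of edges\<close>

text \<open>Spine vertices added in front are absorbed into the root with their trees. The
  hypothesis holds for every \<open>s\<close> because they shift the offset of the tail.\<close>

lemma contracts_to_bracket_hanging_mono:
  assumes "k \<le> n" "\<And>s. contracts_to (bracket_from s (hanging f g k)) R"
  shows "contracts_to (bracket_from s (hanging f g n)) R"
  using assms(1)
proof (induction n arbitrary: s rule: dec_induct)
  case base
  show ?case by (rule assms(2))
next
  case (step n)
  show ?case
    unfolding hanging.simps bracket_from.simps
    by (intro contracts_to_join_absorb step.IH built_tree_attachment built_tree_bracket_hanging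
        attachment_bracket_disjoint built_tree_T_seq)
qed

text \<open>The induction hypothesis is used both inside a hanging tree, with another function in
  place of \<open>g\<close>, and on a tail of the spine, with the same \<open>g\<close> and another
  offset; hence \<open>n\<close>, \<open>g\<close> and \<open>s\<close> are general.\<close>

lemma bracket_hanging_contracts_to:
  assumes mono: "\<And>a b k. 1 \<le> k \<Longrightarrow> k \<le> a \<Longrightarrow> a \<le> b \<Longrightarrow> f a k \<le> f b k"
  shows "built_tree R \<Longrightarrow> card (redges R) \<le> n \<Longrightarrow>
    (\<And>k. k \<in> {1..card (redges R)} \<Longrightarrow> f (card (redges R)) k \<le> g k) \<Longrightarrow>
    contracts_to (bracket_from s (hanging f g n)) R"
proof (induction "card (redges R)" arbitrary: R n g s rule: less_induct)
  case less
  note tree_R = less.prems(1)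
  show ?case
  proof (cases "redges R = {}")
    case True
    then show ?thesis
      using built_tree_no_edges[OF tree_R]
        contracts_to_point[OF built_tree_bracket_hanging] by metis
  next
    case False
    obtain A B where AB: "built_tree A" "built_tree B" "rverts B \<inter> rverts A = {}" "R = join B A"
      and small: "redges B = {} \<or> 2 * (card (redges A) + 1) \<le> card (redges R)"
      using tree_R False by (rule built_tree_split_small_branch)
    define a b m where "a = card (redges A)" and "b = card (redges B)" and "m = card (redges R)"
    have m: "m = b + a + 1"
      using built_tree_join_disjoint_edges[OF AB(2,1,3)] by (simp add: a_def b_def m_def AB(4))
    have g: "f m k \<le> g k" if "k \<in> {1..m}" for k using less.prems(3) that by (simp add: m_def)
    \<comment> \<open>\<open>Suc k\<close> is the length of the part of the spine in which
      \<open>R\<close> is found; the spine before it is absorbed at the end.\<close>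
    have "\<exists>k. Suc k \<le> m \<and> (\<forall>s. contracts_to (bracket_from s (hanging f g (Suc k))) R)"
      using small
    proof
      assume "redges B = {}"
      then have B: "B = point (rroot B)" and ma: "m = Suc a"
        using built_tree_no_edges[OF AB(2)] m by (auto simp: b_def)
      have "contracts_to (bracket_from s (hanging f g (Suc a))) R" for s
        unfolding hanging.simps bracket_from.simps AB(4)
      proof (rule contracts_to_join)
        show tree_at: "built_tree (attachment (Suc s) (T_seq f (int (g (Suc a)) - 1)))"
          by (intro built_tree_attachment built_tree_T_seq)
        \<comment> \<open>The tree at the first spine vertex collapses into that vertex, which
          represents the root of \<open>R\<close>.\<close>
        show "contracts_to (attachment (Suc s) (T_seq f (int (g (Suc a)) - 1))) B"
          by (subst B) (rule contracts_to_point[OF tree_at])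
        show "contracts_to (bracket_from (Suc s) (hanging f g a)) A"
        proof (rule less.hyps)
          fix k assume k: "k \<in> {1..card (redges A)}"
          then have "f a k \<le> f m k" using ma by (intro mono) (auto simp: a_def)
          also have "f m k \<le> g k" using k ma by (intro g) (auto simp: a_def)
          finally show "f (card (redges A)) k \<le> g k" by (simp add: a_def)
        qed (use AB ma in \<open>auto simp: a_def m_def\<close>)
      qed (use AB built_tree_bracket_hanging attachment_bracket_disjoint in auto)
      then show ?thesis using ma by blast
    next
      assume "2 * (card (redges A) + 1) \<le> card (redges R)"
      then have "a + 1 \<le> m div 2" by (simp add: a_def m_def)
      \<comment> \<open>The condition defining \<open>F_set m\<close>, taken at
        \<open>n = m\<close>; it is applied with \<open>i = a + 1\<close>, the size of the branch
        \<open>A\<close> with its root edge.\<close>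
      moreover have "\<exists>j. m - i + 1 \<le> j \<and> j \<le> m \<and> i \<le> f m j" if "1 \<le> i" "i \<le> m div 2" for i
        using f_in[of m] m that unfolding F_set_def by simp
      ultimately obtain j where j: "m - (a + 1) + 1 \<le> j" "j \<le> m" "a + 1 \<le> f m j"
        by (metis le_add2)
      \<comment> \<open>From \<open>m = b + a + 1\<close> follows \<open>j > b\<close>, so the spine
        behind the chosen vertex has room for \<open>B\<close>.\<close>
      then obtain k where k: "j = Suc k" "b \<le> k" using m by (cases j) auto
      define c where "c = g j - 1"
      have gj: "a + 1 \<le> g j" using g[of j] j k by auto
      then have T: "T_seq f (int (g j) - 1) = Some (Tree_F f c)" by (simp add: T_seq_pred c_def)
      \<comment> \<open>The hanging tree is a bracket for \<open>f c\<close> with \<open>c\<close>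
        at least \<open>a\<close>, so the induction hypothesis applies with \<open>f c\<close> in
        place of \<open>g\<close>.\<close>
      have A: "contracts_to (Tree_F f c) A"
        unfolding Tree_F_unfold
      proof (rule less.hyps)
        show "card (redges A) \<le> c" using gj by (simp add: c_def a_def)
        then show "f (card (redges A)) k \<le> f c k" if "k \<in> {1..card (redges A)}" for k
          using that by (intro mono) auto
      qed (use AB m in \<open>auto simp: a_def m_def\<close>)
      \<comment> \<open>On \<open>{1..b}\<close> monotonicity gives \<open>f b\<close> below
        \<open>f m\<close>, which is below \<open>g\<close>.\<close>
      have B: "contracts_to (bracket_from s (hanging f g k)) B" for s
      proof (rule less.hyps)
        fix i assume i: "i \<in> {1..card (redges B)}"
        then have "f b i \<le> f m i" using m by (intro mono) (auto simp: b_def)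
        also have "f m i \<le> g i" using i m by (intro g) (auto simp: b_def)
        finally show "f (card (redges B)) i \<le> g i" by (simp add: b_def)
      qed (use AB m k in \<open>auto simp: b_def m_def\<close>)
      have "contracts_to (bracket_from s (hanging f g (Suc k))) R" for s
      proof -
        let ?p = "point (Spine (Suc s))" and ?C = "map_rgraph (Copy (Suc s)) (Tree_F f c)"
          and ?S = "bracket_from (Suc s) (hanging f g k)"
        have "rverts (join ?p ?C) \<inter> rverts ?S = {}"
          using attachment_bracket_disjoint[of s "Some (Tree_F f c)"] by simp
        then have disj: "rverts ?p \<inter> rverts ?S = {}" "rverts (join ?p ?S) \<inter> rverts ?C = {}"
          by auto
        have tree_C: "built_tree ?C" and to_A: "contracts_to ?C A"
          by (auto intro!: built_tree_map built_tree_Tree_F contracts_to_map A simp: inj_on_def)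
        \<comment> \<open>The copy \<open>?C\<close> is regarded as a branch at \<open>?p\<close>
          with the tail \<open>?S\<close> attached first: \<open>?p\<close> is absorbed into the
          root of \<open>B\<close>, then \<open>?C\<close> supplies \<open>A\<close>.\<close>
        have "contracts_to (join ?p ?S) B" "built_tree (join ?p ?S)"
          using disj(1) by (auto intro!: contracts_to_join_absorb B built_join built_point
              built_tree_bracket_hanging)
        then have "contracts_to (join (join ?p ?S) ?C) (join B A)"
          using to_A tree_C disj(2) AB(3) by (intro contracts_to_join)
        moreover have "bracket_from s (hanging f g (Suc k)) = join (join ?p ?S) ?C"
          using T k by (simp add: join_right_commute[of ?p ?S])
        ultimately show ?thesis by (simp add: AB(4))
      qed
      then show ?thesis using j k by blast
    qed
    then obtain k where "Suc k \<le> m"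
      and "\<And>s. contracts_to (bracket_from s (hanging f g (Suc k))) R" by blast
    then show ?thesis
      using less.prems(2) by (intro contracts_to_bracket_hanging_mono[of "Suc k" n]) (simp add: m_def)
  qed
qed

end

theorem theorem5:
  fixes f :: "nat \<Rightarrow> nat \<Rightarrow> nat" and m :: nat
  assumes "\<And>i. 1 \<le> i \<Longrightarrow> f i \<in> F_set i"
    and "\<And>i k. 1 \<le> i \<Longrightarrow> 1 \<le> k \<Longrightarrow> k \<le> i \<Longrightarrow> f i k \<le> f (i + 1) k"
    and "1 \<le> m"
  shows "strongly_universal TYPE('b) m (Tree_F f m)"
  unfolding strongly_universal_def
proof (intro conjI allI impI)
  have tree: "built_tree (Tree_F f m)" using assms(1) by (rule built_tree_Tree_F)
  then show "rooted_tree (Tree_F f m)" by (rule built_tree_imp_rooted_tree)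
  fix R :: "'b rgraph" assume R: "rooted_tree R \<and> card (redges R) = m"
  have mono: "f a k \<le> f b k" if "1 \<le> k" "k \<le> a" "a \<le> b" for a b k
    using that(3)
  proof (induction b rule: dec_induct)
    case (step b)
    then show ?case using assms(2)[of b k] that by simp
  qed simp
  \<comment> \<open>The case \<open>n = m\<close> and \<open>g = f m\<close>, in which the bracket
    is \<open>Tree_F f m\<close> itself.\<close>
  have "contracts_to (bracket_from 0 (hanging f (f m) m)) R"
    using assms(1) mono by (rule bracket_hanging_contracts_to)
      (use R in \<open>auto intro: rooted_tree_imp_built_tree\<close>)
  then obtain \<phi> where "contraction_map \<phi> (Tree_F f m) R"
    using Tree_F_unfold[of f m] assms(1) unfolding contracts_to_def by auto
  then show "rooted_contraction R (Tree_F f m)"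
    using built_tree_simple[OF tree] built_tree_root[OF tree]
    by (rule contraction_map_imp_rooted_contraction)
qed

end
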